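(* Suppose $r$ has decreasing cross marginal revenue: for every $i\in N$ and all $x_i\ge x_i'\ge0$, $\bm x_{-i}\ge\bm x_{-i}'\ge\bm0$, $$r(x_i,\bm{x}_{-i}) - r(x_i',\bm{x}_{-i})\ \le\ r(x_i,\bm{x}_{-i}') - r(x_i',\bm{x}_{-i}').$$ Let the payment to supplier $i$ be $$p_i(\hat{\bm x},\hat{\bm\gamma})=\{r(\bm{x}^* ) - r(\bm{z}_{i}^* )\}-\sum_{k=1, k\ne i}^{n}\{c(x_k^*, \hat{\gamma}_k) - c(z_{ik}^*, \hat{\gamma}_k)\},$$ where $\bm x^*=\bm x^*(\hat{\bm x},\hat{\bm\gamma})$ and $\bm z_i^*=(z_{i1}^*,\dots,z_{in}^* )$ is the optimal allocation when supplier $i$'s capacity is set to $0$. If reports are truthful, $(\hat{\bm x},\hat{\bm\gamma})=(\bar{\bm x},\bm\gamma)$, then the rule is ex-post weakly budget balanced: $$\sum_{i=1}^n p_i(\bar{\bm x},\bm\gamma)\ \le\ r(\bm x^*(\bar{\bm x},\bm\gamma)).$$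
   Context: There are $n$ suppliers $N=\{1,\dots,n\}$. Supplier $i$ supplies an amount $x_i\ge0$; $\bm x\in\mathbb{R}_{\ge0}^n$ is the procurement level. Supplier $i$ has a true capacity limit $\bar x_i\ge0$ and a true cost type $\gamma_i$ in a set $\Gamma$; its cost of supplying $x_i$ is $c(x_i,\gamma_i)$. The coordinator's revenue is $r(\bm x)$. For a vector $\bm y$, $\bm y_{-i}$ is $\bm y$ with the $i$th entry removed, and $(a,\bm y_{-i})$ is the vector with $i$th entry $a$ and remaining entries from $\bm y_{-i}$. Inequalities between vectors are componentwise. Standing assumptions: $r$ is smooth and monotonically increasing (in each coordinate) on $\mathbb{R}_{\ge0}^n$; for each $\gamma\in\Gamma$, $c(\cdot,\gamma)$ is smooth and monotonically increasing on $\mathbb{R}_{\ge0}$; $r(\bm 0)=0$ and $c(0,\gamma)=0$ for all $\gamma\in\Gamma$. Suppliers report capacity limits $\hat{\bm x}\ge\bm0$ and cost types $\hat{\bm\gamma}\in\Gamma^n$. The social surplus is $S(\bm x,\bm\gamma)=r(\bm x)-\sum_{i=1}^n c(x_i,\gamma_i)$. The allocation $\bm x^*(\hat{\bm x},\hat{\bm\gamma})$ is a (fixed choice of) maximizer of $S(\bm x,\hat{\bm\gamma})$ over $\bm0\le\bm x\le\hat{\bm x}$, and $\bm z_i^*$ is a (fixed choice of) maximizer of $S(\bm z,\hat{\bm\gamma})$ over $\bm0\le\bm z\le(0,\hat{\bm x}_{-i})$ (so $z_{ii}^*=0$). Weak budget balance means the total payment to suppliers does not exceed the coordinator's revenue.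 *)

theory Defs
  imports "HOL-Analysis.Analysis"
begin

(* For open U in a finite-dimensional space this says that f is k times continuously
   differentiable on U: the iterated directional derivatives up to order k exist as
   Frechet derivatives and are continuous. *)
primrec Ck_on :: "nat \<Rightarrow> 'a::euclidean_space set \<Rightarrow> ('a \<Rightarrow> real) \<Rightarrow> bool" where
  "Ck_on 0 U f \<longleftrightarrow> continuous_on U f"
| "Ck_on (Suc k) U f \<longleftrightarrow>
     (\<forall>x\<in>U. f differentiable (at x)) \<and>
     (\<forall>v. Ck_on k U (\<lambda>x. frechet_derivative f (at x) v))"

(* S need not be open (here: the closed nonnegative orthant or half-line), so smoothness on S
   means having a smooth extension to an open neighbourhood of S. *)
definition smooth_on :: "'a::euclidean_space set \<Rightarrow> ('a \<Rightarrow> real) \<Rightarrow> bool" where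
  "smooth_on S f \<longleftrightarrow>
     (\<exists>U g. open U \<and> S \<subseteq> U \<and> (\<forall>k. Ck_on k U g) \<and> (\<forall>x\<in>S. g x = f x))"

(* (a, y_{-i}): the i-th entry of y is irrelevant. *)
definition with_entry :: "'n \<Rightarrow> real \<Rightarrow> real ^ 'n \<Rightarrow> real ^ 'n::finite" where
  "with_entry i a y = (\<chi> k. if k = i then a else y $ k)"

definition increasing_in_each_coordinate :: "(real ^ 'n::finite \<Rightarrow> real) \<Rightarrow> bool" where
  "increasing_in_each_coordinate r \<longleftrightarrow>
     (\<forall>i y. 0 \<le> y \<longrightarrow> mono_on {0..} (\<lambda>a. r (with_entry i a y)))"

definition decreasing_cross_marginal_revenue :: "(real ^ 'n::finite \<Rightarrow> real) \<Rightarrow> bool" where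
  "decreasing_cross_marginal_revenue r \<longleftrightarrow>
     (\<forall>i a a' y y'. 0 \<le> a' \<and> a' \<le> a \<and> (\<forall>k. k \<noteq> i \<longrightarrow> 0 \<le> y' $ k \<and> y' $ k \<le> y $ k) \<longrightarrow>
        r (with_entry i a y) - r (with_entry i a' y)
          \<le> r (with_entry i a y') - r (with_entry i a' y'))"

definition social_surplus ::
  "(real ^ 'n::finite \<Rightarrow> real) \<Rightarrow> (real \<Rightarrow> 'g \<Rightarrow> real) \<Rightarrow> real ^ 'n \<Rightarrow> ('n \<Rightarrow> 'g) \<Rightarrow> real" where
  "social_surplus r c x \<gamma> = r x - (\<Sum>i\<in>UNIV. c (x $ i) (\<gamma> i))"

(* The order on real ^ 'n is componentwise. *)
definition optimal_allocation ::
  "(real ^ 'n::finite \<Rightarrow> real) \<Rightarrow> (real \<Rightarrow> 'g \<Rightarrow> real) \<Rightarrow> real ^ 'n \<Rightarrow> ('n \<Rightarrow> 'g) \<Rightarrow> real ^ 'n \<Rightarrow> bool" where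
  "optimal_allocation r c u \<gamma> x \<longleftrightarrow>
     is_arg_max (\<lambda>x. social_surplus r c x \<gamma>) (\<lambda>x. 0 \<le> x \<and> x \<le> u) x"

definition payment ::
  "(real ^ 'n::finite \<Rightarrow> real) \<Rightarrow> (real \<Rightarrow> 'g \<Rightarrow> real) \<Rightarrow>
   (real ^ 'n \<Rightarrow> ('n \<Rightarrow> 'g) \<Rightarrow> real ^ 'n) \<Rightarrow> ('n \<Rightarrow> real ^ 'n \<Rightarrow> ('n \<Rightarrow> 'g) \<Rightarrow> real ^ 'n) \<Rightarrow>
   'n \<Rightarrow> real ^ 'n \<Rightarrow> ('n \<Rightarrow> 'g) \<Rightarrow> real" where
  "payment r c xstar zstar i xhat \<gamma>hat =
     (let x = xstar xhat \<gamma>hat; z = zstar i xhat \<gamma>hat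
      in (r x - r z) - (\<Sum>k\<in>UNIV - {i}. c (x $ k) (\<gamma>hat k) - c (z $ k) (\<gamma>hat k)))"

end

(* Write x for the optimal allocation. Dropping its i-th entry to 0 is feasible for the problem
   without supplier i, so the payment to i is at most the marginal revenue r(x) - r(0, x_{-i}).
   Under decreasing cross marginal revenue this is at most the marginal revenue of supplier i when
   only the suppliers preceding it are active, and these telescope to r(x) - r(0). *)
theory Submission imports Defs begin

lemma with_entry_nth [simp]: "with_entry i a y $ k = (if k = i then a else y $ k)"
  by (simp add: with_entry_def)

lemma with_entry_self [simp]: "with_entry i (y $ i) y = y"
  by (simp add: vec_eq_iff)

lemma optimal_allocation_feasible:
  assumes "optimal_allocation r c u \<gamma> x"
  shows "0 \<le> x" "x \<le> u"
  using assms by (simp_all add: optimal_allocation_def is_arg_max_def)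

lemma optimal_allocation_ge:
  assumes "optimal_allocation r c u \<gamma> x" "0 \<le> y" "y \<le> u"
  shows "social_surplus r c y \<gamma> \<le> social_surplus r c x \<gamma>"
  using assms by (auto simp: optimal_allocation_def is_arg_max_def not_less)

text \<open>An arbitrary set \<open>A\<close> lets the induction activate one supplier at a time, in
  any order. The marginal revenues on the left are all taken at the full \<open>x\<close>, while the
  telescoping happens along truncations of \<open>x\<close>.\<close>

lemma sum_marginal_revenue_le:
  fixes r :: "real ^ 'n::finite \<Rightarrow> real"
  assumes dcmr: "decreasing_cross_marginal_revenue r" and x: "0 \<le> x"
  shows "(\<Sum>i\<in>A. r x - r (with_entry i 0 x)) \<le> r (\<chi> k. if k \<in> A then x $ k else 0) - r 0"
  using finite[of A]
proof (induction A rule: finite_induct)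
  case empty
  have "(\<chi> k. 0) = (0 :: real ^ 'n)" by (simp add: vec_eq_iff)
  then show ?case by simp
next
  case (insert i A)
  let ?x = "\<lambda>B. \<chi> k. if k \<in> B then x $ k else 0"
  \<comment> \<open>Since \<open>i\<close> is not in \<open>A\<close>, the truncation already
    vanishes at \<open>i\<close>; setting that entry to \<open>x $ i\<close> gives the next
    truncation.\<close>
  have "with_entry i (x $ i) (?x A) = ?x (insert i A)" "with_entry i 0 (?x A) = ?x A"
    using insert.hyps by (auto simp: vec_eq_iff)
  \<comment> \<open>Nonnegativity of \<open>x\<close> puts each truncation between 0 and
    \<open>x\<close>, so decreasing cross marginal revenue applies.\<close>
  moreover have "r (with_entry i (x $ i) x) - r (with_entry i 0 x)
      \<le> r (with_entry i (x $ i) (?x A)) - r (with_entry i 0 (?x A))"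
    using x by (intro dcmr[unfolded decreasing_cross_marginal_revenue_def, rule_format])
      (auto simp: less_eq_vec_def)
  ultimately show ?case
    using insert by simp
qed

text \<open>The payment is \<open>r\<close> at the optimum, less the other suppliers' costs there,
  less the best surplus without \<open>i\<close>. Bounding the latter below by the surplus of the
  optimum with entry \<open>i\<close> set to 0 makes those costs cancel.\<close>

lemma payment_le_marginal_revenue:
  fixes r :: "real ^ 'n::finite \<Rightarrow> real"
  assumes x: "optimal_allocation r c u \<gamma> (xstar u \<gamma>)"
    and z: "optimal_allocation r c (with_entry i 0 u) \<gamma> (zstar i u \<gamma>)"
    and c0: "c 0 (\<gamma> i) = 0"
  shows "payment r c xstar zstar i u \<gamma> \<le> r (xstar u \<gamma>) - r (with_entry i 0 (xstar u \<gamma>))"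
proof -
  let ?x = "xstar u \<gamma>" and ?z = "zstar i u \<gamma>"
  \<comment> \<open>A zero supply costs nothing by \<open>c0\<close>, so the surplus takes the form
    occurring in the payment, whose cost sum omits \<open>i\<close>.\<close>
  have surplus: "social_surplus r c y \<gamma> = r y - (\<Sum>k\<in>UNIV - {i}. c (y $ k) (\<gamma> k))"
    if "y $ i = 0" for y
    using that c0 sum.remove[of UNIV i "\<lambda>k. c (y $ k) (\<gamma> k)"]
    by (simp add: social_surplus_def)
  have "?z $ i = 0"
  proof (rule antisym)
    show "?z $ i \<le> 0"
      using optimal_allocation_feasible(2)[OF z, unfolded less_eq_vec_def, rule_format, of i] by simp
    show "0 \<le> ?z $ i"
      using optimal_allocation_feasible(1)[OF z, unfolded less_eq_vec_def, rule_format, of i] by simp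
  qed
  moreover have "social_surplus r c (with_entry i 0 ?x) \<gamma> \<le> social_surplus r c ?z \<gamma>"
    using optimal_allocation_feasible[OF x]
    by (intro optimal_allocation_ge[OF z]) (auto simp: less_eq_vec_def)
  moreover have "(\<Sum>k\<in>UNIV - {i}. c (with_entry i 0 ?x $ k) (\<gamma> k))
      = (\<Sum>k\<in>UNIV - {i}. c (?x $ k) (\<gamma> k))"
    by (intro sum.cong) auto
  ultimately have "r (with_entry i 0 ?x) - (\<Sum>k\<in>UNIV - {i}. c (?x $ k) (\<gamma> k))
      \<le> r ?z - (\<Sum>k\<in>UNIV - {i}. c (?z $ k) (\<gamma> k))"
    using surplus[of ?z] surplus[of "with_entry i 0 ?x"] by simp
  then show ?thesis
    by (simp add: payment_def Let_def sum_subtractf)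
qed

theorem proposition4:
  fixes r :: "real ^ 'n::finite \<Rightarrow> real"
    and c :: "real \<Rightarrow> 'g \<Rightarrow> real"
    and \<Gamma> :: "'g set"
    and xstar :: "real ^ 'n \<Rightarrow> ('n \<Rightarrow> 'g) \<Rightarrow> real ^ 'n"
    and zstar :: "'n \<Rightarrow> real ^ 'n \<Rightarrow> ('n \<Rightarrow> 'g) \<Rightarrow> real ^ 'n"
    and xbar :: "real ^ 'n"
    and \<gamma> :: "'n \<Rightarrow> 'g"
  assumes r_smooth: "smooth_on {x. 0 \<le> x} r"
    and r_mono: "increasing_in_each_coordinate r"
    and r_zero: "r 0 = 0"
    and c_smooth: "\<And>g. g \<in> \<Gamma> \<Longrightarrow> smooth_on {0..} (\<lambda>t. c t g)"
    and c_mono: "\<And>g. g \<in> \<Gamma> \<Longrightarrow> mono_on {0..} (\<lambda>t. c t g)"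
    and c_zero: "\<And>g. g \<in> \<Gamma> \<Longrightarrow> c 0 g = 0"
    and xstar_opt: "\<And>xhat \<gamma>hat. 0 \<le> xhat \<Longrightarrow> (\<forall>i. \<gamma>hat i \<in> \<Gamma>) \<Longrightarrow>
          optimal_allocation r c xhat \<gamma>hat (xstar xhat \<gamma>hat)"
    and zstar_opt: "\<And>i xhat \<gamma>hat. 0 \<le> xhat \<Longrightarrow> (\<forall>i. \<gamma>hat i \<in> \<Gamma>) \<Longrightarrow>
          optimal_allocation r c (with_entry i 0 xhat) \<gamma>hat (zstar i xhat \<gamma>hat)"
    and dcmr: "decreasing_cross_marginal_revenue r"
    and xbar_nonneg: "0 \<le> xbar"
    and \<gamma>_types: "\<forall>i. \<gamma> i \<in> \<Gamma>"
  shows "(\<Sum>i\<in>UNIV. payment r c xstar zstar i xbar \<gamma>) \<le> r (xstar xbar \<gamma>)"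
proof -
  let ?x = "xstar xbar \<gamma>"
  note opt = xstar_opt[OF xbar_nonneg \<gamma>_types]
  have "(\<Sum>i\<in>UNIV. payment r c xstar zstar i xbar \<gamma>)
      \<le> (\<Sum>i\<in>UNIV. r ?x - r (with_entry i 0 ?x))"
    using opt zstar_opt[OF xbar_nonneg \<gamma>_types] c_zero[OF \<gamma>_types[rule_format]]
    by (intro sum_mono payment_le_marginal_revenue)
  \<comment> \<open>For \<open>UNIV\<close> the truncation is the whole allocation, and the baseline
    revenue is 0.\<close>
  also have "\<dots> \<le> r ?x"
    using sum_marginal_revenue_le[OF dcmr optimal_allocation_feasible(1)[OF opt], of UNIV]
    by (simp add: r_zero)
  finally show ?thesis .
qed

end
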